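(* Let $s\in(0,1)$, let $k\in\mathbb{N}$, let $c=(c_1,\dots,c_k)$ with $c_i>0$ for all $i$, and let $\Omega\subseteq\mathbb{R}^d$ be a bounded open set of finite perimeter. Let $(\bar E_1,\dots,\bar E_k)$ be an exterior datum, i.e. disjoint measurable sets $\bar E_i\subseteq\mathbb{R}^d\setminus\Omega$ with $\bigcup_{i}\bar E_i=\mathbb{R}^d\setminus\Omega$. Then the Dirichlet problem $$\inf\{\mathcal{P}_{s,c}(\mathcal{E};\Omega)\ :\ \mathcal{E}=(E_1,\dots,E_k)\text{ a }k\text{-cluster},\ E_i\setminus\Omega=\bar E_i\ \text{for all } i\}$$ admits a solution, i.e. the infimum is attained.
   Context: A $k$-cluster is a family $\mathcal{E}=(E_i)_{i=1,\dots,k}$ of disjoint measurable subsets of $\mathbb{R}^d$ (the phases) such that $\bigcup_i E_i=\mathbb{R}^d$ up to a negligible set. For measurable $A,B\subset\mathbb{R}^d$ with $|A\cap B|=0$ put $J_s(A,B)=\int_A\int_B\frac{1}{|x-y|^{d+s}}\,dx\,dy$. The fractional perimeter of $E\subset\mathbb{R}^d$ relative to $\Omega$ is $\mathrm{Per}_s(E;\Omega)=J_s(E\cap\Omega,\mathbb{R}^d\setminus E)+J_s(\Omega\setminus E,E\setminus\Omega)$. The weighted fractional perimeter of a cluster is $\mathcal{P}_{s,c}(\mathcal{E};\Omega)=\sum_{i=1}^k c_i\,\mathrm{Per}_s(E_i;\Omega)$. *)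

theory Defs
  imports "HOL-Analysis.Analysis"
begin

section \<open>Sets of finite perimeter\<close>

text \<open>De Giorgi's perimeter: the supremum of the integral over the set of the divergence of
  \<open>\<phi>\<close>, where \<open>\<phi>\<close> ranges over the compactly supported \<open>C\<^sup>1\<close> vector fields with
  Euclidean norm at most 1.\<close>

definition divergence :: "('a::euclidean_space \<Rightarrow> 'a) \<Rightarrow> 'a \<Rightarrow> real" where
  "divergence \<phi> x = (\<Sum>b\<in>Basis. frechet_derivative \<phi> (at x) b \<bullet> b)"

definition test_fields :: "('a::euclidean_space \<Rightarrow> 'a) set" where
  "test_fields = {\<phi>. (\<forall>x. \<phi> differentiable at x)
      \<and> (\<forall>b\<in>Basis. continuous_on UNIV (\<lambda>x. frechet_derivative \<phi> (at x) b))
      \<and> compact (closure {x. \<phi> x \<noteq> 0})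
      \<and> (\<forall>x. norm (\<phi> x) \<le> 1)}"

definition perimeter :: "'a::euclidean_space set \<Rightarrow> ereal" where
  "perimeter E = (SUP \<phi>\<in>test_fields. ereal (LINT x:E|lebesgue. divergence \<phi> x))"

definition finite_perimeter :: "'a::euclidean_space set \<Rightarrow> bool" where
  "finite_perimeter E \<longleftrightarrow> E \<in> sets lebesgue \<and> perimeter E < \<infinity>"

section \<open>Fractional perimeter\<close>

text \<open>Both integrals take values in \<open>[0, \<infinity>]\<close>. On the null set \<open>x = y\<close> the integrand is 0 by the
  conventions for \<open>powr\<close> and division; this does not affect the integral.\<close>

definition frac_interaction :: "real \<Rightarrow> 'a::euclidean_space set \<Rightarrow> 'a set \<Rightarrow> ennreal" where
  "frac_interaction s A B =
     (\<integral>\<^sup>+x\<in>A. (\<integral>\<^sup>+y\<in>B. ennreal (1 / norm (x - y) powr (real DIM('a) + s)) \<partial>lebesgue) \<partial>lebesgue)"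

definition frac_perimeter :: "real \<Rightarrow> 'a::euclidean_space set \<Rightarrow> 'a set \<Rightarrow> ennreal" where
  "frac_perimeter s E \<Omega> =
     frac_interaction s (E \<inter> \<Omega>) (UNIV - E) + frac_interaction s (\<Omega> - E) (E - \<Omega>)"

section \<open>Clusters and the Dirichlet problem\<close>

text \<open>A family \<open>(E\<^sub>1, \<dots>, E\<^sub>k)\<close> is a function on \<^typ>\<open>nat\<close> of which only the values on \<open>{1..k}\<close>
  matter.\<close>

definition cluster :: "nat \<Rightarrow> (nat \<Rightarrow> 'a::euclidean_space set) \<Rightarrow> bool" where
  "cluster k E \<longleftrightarrow>
     (\<forall>i\<in>{1..k}. E i \<in> sets lebesgue)
     \<and> disjoint_family_on E {1..k}
     \<and> negligible (UNIV - (\<Union>i\<in>{1..k}. E i))"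

definition weighted_frac_perimeter ::
  "real \<Rightarrow> (nat \<Rightarrow> real) \<Rightarrow> nat \<Rightarrow> (nat \<Rightarrow> 'a::euclidean_space set) \<Rightarrow> 'a set \<Rightarrow> ennreal" where
  "weighted_frac_perimeter s c k E \<Omega> = (\<Sum>i=1..k. ennreal (c i) * frac_perimeter s (E i) \<Omega>)"

definition exterior_datum ::
  "nat \<Rightarrow> 'a::euclidean_space set \<Rightarrow> (nat \<Rightarrow> 'a set) \<Rightarrow> bool" where
  "exterior_datum k \<Omega> D \<longleftrightarrow>
     (\<forall>i\<in>{1..k}. D i \<in> sets lebesgue \<and> D i \<subseteq> UNIV - \<Omega>)
     \<and> disjoint_family_on D {1..k}
     \<and> (\<Union>i\<in>{1..k}. D i) = UNIV - \<Omega>"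

definition competitors ::
  "nat \<Rightarrow> 'a::euclidean_space set \<Rightarrow> (nat \<Rightarrow> 'a set) \<Rightarrow> (nat \<Rightarrow> 'a set) set" where
  "competitors k \<Omega> D = {E. cluster k E \<and> (\<forall>i\<in>{1..k}. E i - \<Omega> = D i)}"

end

theory Submission
  imports Defs "HOL-Library.Diagonal_Subsequence"
begin

text \<open>
  The proof is the direct method. If the infimum is infinite, every competitor attains it, and
  competitors exist. If it is finite, a minimizing sequence has bounded energy, and two facts are
  needed: compactness of clusters of bounded energy, and lower semicontinuity of the energy along
  the convergence that compactness provides.

  Compactness uses only that a set of small fractional perimeter is nearly constant on small cubes.
  Cut space into dyadic cells of side \<open>2\<^bsup>-m\<^esup>\<close>. If \<open>x \<in> E \<inter> \<Omega>\<close> and at least half of the cell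
  of \<open>x\<close> lies outside \<open>E\<close>, then the integral of the kernel \<open>1 / |x - y|\<^bsup>d+s\<^esup>\<close> over the complement
  of \<open>E\<close> is at least a constant times \<open>2\<^bsup>m(d+s)\<^esup> 2\<^bsup>-md\<^esup> = 2\<^bsup>ms\<^esup>\<close>. Markov's inequality bounds the
  measure of all such \<open>x\<close> by a constant times \<open>2\<^bsup>-ms\<^esup>\<close> times the energy
  (\<open>nondominant_part_measure_le\<close>). Away from a set of this measure, the phase of a point is
  therefore the phase that fills more than half of its cell; which phase that is, cell by cell, is
  finitely much information, because a bounded set meets finitely many cells. A diagonal argument
  makes this information agree at level \<open>n\<close> for the \<open>n\<close>-th and the next term of a subsequence, so
  these two terms differ inside \<open>\<Omega>\<close> only on a set of measure \<open>O(2\<^bsup>-ns\<^esup>)\<close>. These measures are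
  summable, and by Borel-Cantelli almost every point of \<open>\<Omega>\<close> eventually stays in one phase
  (\<open>cluster_subsequence_with_ae_stable_phases\<close>). Outside \<open>\<Omega>\<close> the phases never change, so the
  eventual phases form a competitor.

  For lower semicontinuity, a point of the limit phase eventually lies in the phases of the
  sequence, and likewise for complements. Fatou's lemma, applied to the inner and then to the outer
  integral, gives the inequality for each interaction (\<open>frac_interaction_le_liminf\<close>), and the
  limit inferior is superadditive.
\<close>

section \<open>Dyadic cells\<close>

text \<open>The cell of side \<open>2\<^bsup>-m\<^esup>\<close> around a point, given as the set of points with the same rounded-down
coordinates. In this form two cells of one level visibly coincide or are disjoint.\<close>

definition dyadic_cell :: "nat \<Rightarrow> 'a::euclidean_space \<Rightarrow> 'a set" where
  "dyadic_cell m x = {y. \<forall>b\<in>Basis. \<lfloor>2 ^ m * (y \<bullet> b)\<rfloor> = \<lfloor>2 ^ m * (x \<bullet> b)\<rfloor>}"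

lemma self_in_dyadic_cell: "x \<in> dyadic_cell m x"
  by (simp add: dyadic_cell_def)

lemma dyadic_cell_eq: "y \<in> dyadic_cell m x \<Longrightarrow> dyadic_cell m y = dyadic_cell m x"
  by (auto simp: dyadic_cell_def)

text \<open>A cell is determined by a vector of integers indexed by the basis. Counting these vectors counts
cells.\<close>

lemma dyadic_cell_eq_image:
  "dyadic_cell m x = (\<lambda>z. {y. \<forall>b\<in>Basis. \<lfloor>2 ^ m * (y \<bullet> b)\<rfloor> = z b})
     (restrict (\<lambda>b. \<lfloor>2 ^ m * (x \<bullet> b)\<rfloor>) Basis)"
  by (auto simp: dyadic_cell_def)

lemma dyadic_cell_borel [measurable]: "dyadic_cell m (x :: 'a::euclidean_space) \<in> sets borel"
proof -
  have "{y :: 'a. \<lfloor>2 ^ m * (y \<bullet> b)\<rfloor> = z} \<in> sets borel" for b and z :: int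
    by measurable
  moreover have "dyadic_cell m x = (\<Inter>b\<in>Basis. {y. \<lfloor>2 ^ m * (y \<bullet> b)\<rfloor> = \<lfloor>2 ^ m * (x \<bullet> b)\<rfloor>})"
    by (auto simp: dyadic_cell_def)
  ultimately show ?thesis
    by (auto intro!: sets.finite_INT)
qed

lemma countable_dyadic_cells: "countable (range (dyadic_cell m :: 'a::euclidean_space \<Rightarrow> 'a set))"
proof (rule countable_subset)
  show "range (dyadic_cell m :: 'a \<Rightarrow> 'a set) \<subseteq>
      (\<lambda>z. {y. \<forall>b\<in>Basis. \<lfloor>2 ^ m * (y \<bullet> b)\<rfloor> = z b}) ` (\<Pi>\<^sub>E b\<in>Basis. UNIV)"
    unfolding dyadic_cell_eq_image by (intro image_subsetI imageI) auto
  show "countable \<dots>"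
    by (intro countable_image countable_PiE) auto
qed

lemma finite_dyadic_cells:
  assumes "bounded (\<Omega> :: 'a::euclidean_space set)"
  shows "finite (dyadic_cell m ` \<Omega>)"
proof -
  obtain R where R: "\<And>x. x \<in> \<Omega> \<Longrightarrow> norm x \<le> R"
    using assms by (auto simp: bounded_iff)
  have "\<lfloor>2 ^ m * (x \<bullet> b)\<rfloor> \<in> {\<lfloor>- (2 ^ m * R)\<rfloor>..\<lfloor>2 ^ m * R\<rfloor>}" if "x \<in> \<Omega>" "b \<in> Basis" for x b
  proof -
    have "\<bar>x \<bullet> b\<bar> \<le> R"
      using Basis_le_norm[OF that(2), of x] R[OF that(1)] by linarith
    then have "x \<bullet> b \<le> R" "- R \<le> x \<bullet> b"
      by linarith+
    then have "2 ^ m * (x \<bullet> b) \<le> 2 ^ m * R" "2 ^ m * - R \<le> 2 ^ m * (x \<bullet> b)"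
      by (intro mult_left_mono; simp)+
    then show ?thesis
      by (auto intro!: floor_mono)
  qed
  then have "dyadic_cell m ` \<Omega> \<subseteq>
      (\<lambda>z. {y. \<forall>b\<in>Basis. \<lfloor>2 ^ m * (y \<bullet> b)\<rfloor> = z b}) `
        (\<Pi>\<^sub>E b\<in>Basis. {\<lfloor>- (2 ^ m * R)\<rfloor>..\<lfloor>2 ^ m * R\<rfloor>})"
    unfolding dyadic_cell_eq_image by (intro image_subsetI imageI) auto
  then show ?thesis
    by (rule finite_subset) (intro finite_imageI finite_PiE; simp)
qed

text \<open>Any condition on a point that depends on its cell alone defines a Borel set, since there are only
countably many cells.\<close>

lemma union_of_dyadic_cells_borel:
  assumes "\<And>x. x \<in> S \<Longrightarrow> dyadic_cell m x \<subseteq> S"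
  shows "S \<in> sets borel"
proof -
  have "S = \<Union>(dyadic_cell m ` S)"
    using assms self_in_dyadic_cell by blast
  moreover have "countable (dyadic_cell m ` S)"
    by (rule countable_subset[OF _ countable_dyadic_cells]) auto
  ultimately show ?thesis
    by (metis (no_types, lifting) dyadic_cell_borel imageE sets.countable_Union subsetI)
qed

lemma dyadic_cell_diameter:
  fixes x y :: "'a::euclidean_space"
  assumes "y \<in> dyadic_cell m x"
  shows "norm (x - y) \<le> real DIM('a) / 2 ^ m"
proof -
  have "\<bar>(x - y) \<bullet> b\<bar> \<le> 1 / 2 ^ m" if "b \<in> Basis" for b
  proof -
    have "\<lfloor>2 ^ m * (y \<bullet> b)\<rfloor> = \<lfloor>2 ^ m * (x \<bullet> b)\<rfloor>"
      using assms that by (auto simp: dyadic_cell_def)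
    then have "\<bar>2 ^ m * (x \<bullet> b) - 2 ^ m * (y \<bullet> b)\<bar> \<le> 1"
      by linarith
    moreover have "\<bar>2 ^ m * (x \<bullet> b) - 2 ^ m * (y \<bullet> b)\<bar> = 2 ^ m * \<bar>(x - y) \<bullet> b\<bar>"
      by (simp add: inner_diff_left abs_mult flip: right_diff_distrib)
    ultimately show ?thesis
      by (simp add: field_simps)
  qed
  then have "(\<Sum>b\<in>Basis. \<bar>(x - y) \<bullet> b\<bar>) \<le> (\<Sum>b\<in>(Basis :: 'a set). 1 / 2 ^ m)"
    by (intro sum_mono) auto
  then show ?thesis
    using norm_le_l1[of "x - y"] by simp
qed

lemma dyadic_cell_volume:
  fixes x :: "'a::euclidean_space"
  shows "ennreal ((1 / 2 ^ m) ^ DIM('a)) \<le> emeasure lebesgue (dyadic_cell m x)"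
proof -
  define l where "l = (\<Sum>b\<in>Basis. (real_of_int \<lfloor>2 ^ m * (x \<bullet> b)\<rfloor> / 2 ^ m) *\<^sub>R b)"
  define u where "u = l + (\<Sum>b\<in>Basis. (1 / 2 ^ m) *\<^sub>R b)"
  have l: "l \<bullet> b = real_of_int \<lfloor>2 ^ m * (x \<bullet> b)\<rfloor> / 2 ^ m"
    and u: "u \<bullet> b = (real_of_int \<lfloor>2 ^ m * (x \<bullet> b)\<rfloor> + 1) / 2 ^ m"
    if "b \<in> Basis" for b
    using that by (simp_all add: l_def u_def inner_add_left add_divide_distrib)
  have "box l u \<subseteq> dyadic_cell m x"
  proof
    fix y assume y: "y \<in> box l u"
    show "y \<in> dyadic_cell m x"
      unfolding dyadic_cell_def mem_Collect_eq
    proof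
      fix b :: 'a assume b: "b \<in> Basis"
      show "\<lfloor>2 ^ m * (y \<bullet> b)\<rfloor> = \<lfloor>2 ^ m * (x \<bullet> b)\<rfloor>"
      proof (rule floor_unique)
        have "l \<bullet> b < y \<bullet> b" "y \<bullet> b < u \<bullet> b"
          using y b by (auto simp: mem_box)
        then show "real_of_int \<lfloor>2 ^ m * (x \<bullet> b)\<rfloor> \<le> 2 ^ m * (y \<bullet> b)"
          and "2 ^ m * (y \<bullet> b) < real_of_int \<lfloor>2 ^ m * (x \<bullet> b)\<rfloor> + 1"
          unfolding l[OF b] u[OF b] by (simp_all add: divide_less_eq less_divide_eq mult.commute)
      qed
    qed
  qed
  then have "emeasure lborel (box l u) \<le> emeasure lebesgue (dyadic_cell m x)"
    by (simp add: emeasure_mono)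
  moreover have "emeasure lborel (box l u) = ennreal (\<Prod>b\<in>(Basis :: 'a set). 1 / 2 ^ m)"
  proof -
    have "(u - l) \<bullet> b = 1 / 2 ^ m" if "b \<in> Basis" for b
      using that by (simp add: u_def inner_diff_left inner_add_left)
    moreover have "l \<bullet> b \<le> u \<bullet> b" if "b \<in> Basis" for b
      using that by (simp add: l u divide_right_mono)
    ultimately show ?thesis
      by (simp cong: prod.cong)
  qed
  ultimately show ?thesis
    by (simp add: power_one_over)
qed

section \<open>Points whose phase does not dominate their cell\<close>

text \<open>On a cell \<open>Q\<close> of level \<open>m\<close>, whose volume is \<open>2\<^bsup>-md\<^esup>\<close>, this says that \<open>E\<close> fills more than half of \<open>Q\<close>.
Measuring the complement makes the negation the lower bound on \<open>Q - E\<close> that the energy estimate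
takes as input.\<close>

definition dominant :: "nat \<Rightarrow> 'a::euclidean_space set \<Rightarrow> 'a set \<Rightarrow> bool" where
  "dominant m E Q \<longleftrightarrow> emeasure lebesgue (Q - E) < ennreal ((1 / 2 ^ m) ^ DIM('a) / 2)"

text \<open>If the sets were disjoint, their complements would cover the cell, although each complement has
less than half of its volume. For the phases of a cluster: at most one phase dominates a cell.\<close>

lemma dominant_not_disjoint:
  fixes E F :: "'a::euclidean_space set"
  assumes [measurable]: "E \<in> sets lebesgue" "F \<in> sets lebesgue"
    and E: "dominant m E (dyadic_cell m x)" and F: "dominant m F (dyadic_cell m x)"
  shows "E \<inter> F \<noteq> {}"
proof
  let ?Q = "dyadic_cell m x" and ?v = "(1 / 2 ^ m :: real) ^ DIM('a)"
  have Q [measurable]: "?Q \<in> sets lebesgue"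
    by simp
  assume "E \<inter> F = {}"
  then have "ennreal ?v \<le> emeasure lebesgue ((?Q - E) \<union> (?Q - F))"
    by (intro order_trans[OF dyadic_cell_volume[of m x]] emeasure_mono sets.Un sets.Diff)
       (auto intro: assms)
  also have "\<dots> \<le> emeasure lebesgue (?Q - E) + emeasure lebesgue (?Q - F)"
    by (intro emeasure_subadditive) auto
  also have "\<dots> < ennreal (?v / 2) + ennreal (?v / 2)"
    using E F unfolding dominant_def by (intro add_strict_mono)
  also have "\<dots> = ennreal ?v"
    by (simp flip: ennreal_plus)
  finally show False
    by simp
qed

lemma nondominant_part_measurable:
  assumes "E \<in> sets lebesgue" "\<Omega> \<in> sets lebesgue"
  shows "{x \<in> E \<inter> \<Omega>. \<not> dominant m E (dyadic_cell m x)} \<in> sets lebesgue"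
proof -
  have "{x. \<not> dominant m E (dyadic_cell m x)} \<in> sets borel"
    by (rule union_of_dyadic_cells_borel[of _ m]) (auto dest: dyadic_cell_eq)
  then have "(E \<inter> \<Omega>) \<inter> {x. \<not> dominant m E (dyadic_cell m x)} \<in> sets lebesgue"
    using assms by auto
  moreover have "{x \<in> E \<inter> \<Omega>. \<not> dominant m E (dyadic_cell m x)} =
      (E \<inter> \<Omega>) \<inter> {x. \<not> dominant m E (dyadic_cell m x)}"
    by auto
  ultimately show ?thesis
    by simp
qed

text \<open>At a point \<open>x\<close> of the set on the left, the part of the cell outside \<open>E\<close> has volume at least half of
\<open>2\<^bsup>-md\<^esup>\<close>, and all its points are within \<open>d 2\<^bsup>-m\<^esup>\<close> of \<open>x\<close>. So the inner integral of the interaction is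
bounded below at \<open>x\<close>, and Markov's inequality applies. The volume of the cell cancels the \<open>d\<close> in
the exponent \<open>d + s\<close> of the kernel and leaves the decay \<open>2\<^bsup>-ms\<^esup>\<close>.\<close>

lemma nondominant_part_measure_le:
  fixes E \<Omega> :: "'a::euclidean_space set"
  assumes s: "0 < s" and E [measurable]: "E \<in> sets lebesgue" and \<Omega> [measurable]: "\<Omega> \<in> sets lebesgue"
  shows "emeasure lebesgue {x \<in> E \<inter> \<Omega>. \<not> dominant m E (dyadic_cell m x)}
    \<le> ennreal (2 * real DIM('a) powr (real DIM('a) + s) * (2 powr - s) ^ m)
        * frac_interaction s (E \<inter> \<Omega>) (UNIV - E)"
proof -
  define p where "p = real DIM('a) + s"
  define \<delta> where "\<delta> = real DIM('a) / 2 ^ m"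
  define v where "v = (1 / 2 ^ m :: real) ^ DIM('a)"
  define t where "t = 1 / \<delta> powr p * (v / 2)"
  define W where "W = {x \<in> E \<inter> \<Omega>. \<not> dominant m E (dyadic_cell m x)}"
  have W [measurable]: "W \<in> sets lebesgue"
    unfolding W_def by (rule nondominant_part_measurable) fact+
  have pos: "0 < p" "0 < \<delta>" "0 < v" "0 < t"
    using s by (simp_all add: p_def \<delta>_def v_def t_def)
  have inner: "ennreal t \<le> (\<integral>\<^sup>+y\<in>UNIV - E. ennreal (1 / norm (x - y) powr p) \<partial>lebesgue)"
    if x: "x \<in> W" for x
  proof -
    let ?Q = "dyadic_cell m x"
    have Q: "?Q - E \<in> sets lebesgue"
      using E by (intro sets.Diff) auto
    have "ennreal t = ennreal (1 / \<delta> powr p) * ennreal (v / 2)"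
      unfolding t_def using pos by (intro ennreal_mult) auto
    also have "\<dots> \<le> ennreal (1 / \<delta> powr p) * emeasure lebesgue (?Q - E)"
      using x by (intro mult_left_mono) (auto simp: W_def dominant_def v_def not_less)
    also have "\<dots> = (\<integral>\<^sup>+y. ennreal (1 / \<delta> powr p) * indicator (?Q - E) y \<partial>lebesgue)"
      using Q by (simp add: nn_integral_cmult_indicator)
    also have "\<dots> \<le> (\<integral>\<^sup>+y\<in>UNIV - E. ennreal (1 / norm (x - y) powr p) \<partial>lebesgue)"
    proof (intro nn_integral_mono)
      fix y
      show "ennreal (1 / \<delta> powr p) * indicator (?Q - E) y
        \<le> ennreal (1 / norm (x - y) powr p) * indicator (UNIV - E) y"
      proof (cases "y \<in> ?Q - E")
        case True
        then have "x \<noteq> y" "norm (x - y) \<le> \<delta>"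
          using x dyadic_cell_diameter[of y m x] by (auto simp: W_def \<delta>_def)
        then have "norm (x - y) powr p \<le> \<delta> powr p" "0 < norm (x - y) powr p"
          using pos by (auto intro!: powr_mono2)
        then have "1 / \<delta> powr p \<le> 1 / norm (x - y) powr p"
          by (intro divide_left_mono mult_pos_pos) auto
        then show ?thesis
          using True by (simp add: ennreal_leI)
      qed simp
    qed
    finally show ?thesis .
  qed
  have "ennreal t * emeasure lebesgue W = (\<integral>\<^sup>+x. ennreal t * indicator W x \<partial>lebesgue)"
    by (simp add: nn_integral_cmult_indicator)
  also have "\<dots> \<le> frac_interaction s (E \<inter> \<Omega>) (UNIV - E)"
    unfolding frac_interaction_def
    using inner by (intro nn_integral_mono) (auto split: split_indicator simp: p_def W_def)
  finally have le: "ennreal t * emeasure lebesgue W \<le> frac_interaction s (E \<inter> \<Omega>) (UNIV - E)" .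
  have "emeasure lebesgue W = ennreal (1 / t) * (ennreal t * emeasure lebesgue W)"
    using pos by (simp flip: mult.assoc ennreal_mult)
  also have "\<dots> \<le> ennreal (1 / t) * frac_interaction s (E \<inter> \<Omega>) (UNIV - E)"
    by (intro mult_left_mono le) auto
  also have "1 / t = 2 * real DIM('a) powr p * (2 powr - s) ^ m"
  proof -
    have "(2 ^ m :: real) powr p = (2 ^ m) ^ DIM('a) * (2 powr s) ^ m"
    proof -
      have "(2 ^ m :: real) powr p = (2 ^ m) powr real DIM('a) * (2 ^ m) powr s"
        by (simp add: p_def powr_add)
      also have "(2 ^ m :: real) powr s = (2 powr s) ^ m"
        by (simp add: powr_powr mult.commute flip: powr_realpow)
      finally show ?thesis
        by (simp add: powr_realpow)
    qed
    then have "1 / t = 2 * real DIM('a) powr p * inverse ((2 powr s) ^ m)"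
      by (simp add: t_def \<delta>_def v_def powr_divide field_simps)
    then show ?thesis
      by (simp add: powr_minus power_inverse)
  qed
  finally show ?thesis
    by (simp add: W_def p_def)
qed

section \<open>Compactness of clusters of bounded energy\<close>

text \<open>By the pigeonhole principle each \<open>f m\<close> is constant along a subsequence, and the diagonal sequence is
eventually a subsequence of each of these. Comparing consecutive terms is enough later, because the
measures of the exceptional sets are summable.\<close>

lemma diagonal_subsequence_of_finite_labels:
  fixes f :: "nat \<Rightarrow> nat \<Rightarrow> 'b"
  assumes fin: "\<And>m. finite (range (f m))"
  obtains r where "strict_mono r" "\<And>m. f m (r (Suc m)) = f m (r m)"
proof -
  define P where "P m t \<longleftrightarrow> (\<forall>j. f m (t j) = f m (t 0))" for m and t :: "nat \<Rightarrow> nat"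
  interpret subseqs P
  proof
    fix m and t :: "nat \<Rightarrow> nat"
    assume "strict_mono t"
    have "finite (range (\<lambda>j. f m (t j)))"
      by (rule finite_subset[OF _ fin[of m]]) auto
    then obtain j0 where "infinite {j. f m (t j) = f m (t j0)}"
      using pigeonhole_infinite[of "UNIV :: nat set" "\<lambda>j. f m (t j)"] by auto
    then obtain r' :: "nat \<Rightarrow> nat" where "strict_mono r'" "\<And>n. r' n \<in> {j. f m (t j) = f m (t j0)}"
      using infinite_enumerate by blast
    then show "\<exists>r'. strict_mono r' \<and> P m (t \<circ> r')"
      by (intro exI[of _ r']) (auto simp: P_def)
  qed
  have "P m (diagseq \<circ> (+) (Suc m))" for m
  proof (rule diagseq_holds)
    fix n and r t :: "nat \<Rightarrow> nat"
    assume "P n t"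
    then show "P n (t \<circ> r)"
      unfolding P_def comp_def by metis
  qed
  then have "f m (diagseq (Suc m + 1)) = f m (diagseq (Suc m + 0))" for m
    unfolding P_def comp_def by blast
  then show thesis
    using subseq_diagseq
    \<comment> \<open>Label \<open>m\<close> is constant on the diagonal sequence only from index \<open>Suc m\<close> on, hence the shift.\<close>
    by (intro that[of "\<lambda>n. diagseq (Suc n)"]) (auto simp: strict_mono_def)
qed

text \<open>The label of a term at level \<open>m\<close> records which phases dominate which cells meeting \<open>\<Omega>\<close>. If two
clusters have the same label, then almost every point of \<open>\<Omega>\<close> that is exceptional for neither of
them lies in the same phase of both, namely the dominant phase of its cell. The exceptional sets of consecutive
terms have geometrically small measure.\<close>

lemma cluster_subsequence_with_ae_stable_phases:
  fixes E :: "nat \<Rightarrow> 'i \<Rightarrow> 'a::euclidean_space set"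
  assumes s: "0 < s" and I: "finite I"
    and \<Omega>: "\<Omega> \<in> sets lebesgue" "bounded \<Omega>"
    and E: "\<And>n i. i \<in> I \<Longrightarrow> E n i \<in> sets lebesgue"
    and disj: "\<And>n. disjoint_family_on (E n) I"
    and cover: "\<And>n. AE x in lebesgue. x \<in> (\<Union>i\<in>I. E n i)"
    and energy: "\<And>n. (\<Sum>i\<in>I. frac_interaction s (E n i \<inter> \<Omega>) (UNIV - E n i)) \<le> ennreal M"
  obtains r where "strict_mono r"
    "AE x in lebesgue. x \<in> \<Omega> \<longrightarrow> (\<exists>i\<in>I. \<forall>\<^sub>F n in sequentially. x \<in> E (r n) i)"
proof -
  define label where
    "label m n = {(i, Q). i \<in> I \<and> Q \<in> dyadic_cell m ` \<Omega> \<and> dominant m (E n i) Q}" for m n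
  have "finite (range (label m))" for m
  proof (rule finite_subset)
    show "range (label m) \<subseteq> Pow (I \<times> dyadic_cell m ` \<Omega>)"
      by (auto simp: label_def)
    show "finite (Pow (I \<times> dyadic_cell m ` \<Omega>))"
      using I finite_dyadic_cells[OF \<Omega>(2)] by simp
  qed
  then obtain r where r: "strict_mono r" and label: "\<And>m. label m (r (Suc m)) = label m (r m)"
    using diagonal_subsequence_of_finite_labels[of label] by blast

  \<comment> \<open>The exceptional points: those whose own phase does not dominate their cell.\<close>
  define bad where
    "bad m n = (\<Union>i\<in>I. {x \<in> E n i \<inter> \<Omega>. \<not> dominant m (E n i) (dyadic_cell m x)})" for m n
  have bad_meas: "bad m n \<in> sets lebesgue" for m n
    unfolding bad_def by (intro sets.finite_UN I nondominant_part_measurable E \<Omega>)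
  define C where "C = 2 * real DIM('a) powr (real DIM('a) + s)"
  define q where "q = 2 powr - s"
  have "0 \<le> C" "0 < q" "q < 1"
    using s powr_less_mono[of "-s" 0 2] by (simp_all add: C_def q_def)
  \<comment> \<open>\<open>ennreal\<close> truncates negative arguments, so the bound for arbitrary \<open>M\<close> involves \<open>max M 0\<close>.\<close>
  have bad_le: "emeasure lebesgue (bad m n) \<le> ennreal (C * max M 0 * q ^ m)" for m n
  proof -
    have "emeasure lebesgue (bad m n) \<le>
        (\<Sum>i\<in>I. emeasure lebesgue {x \<in> E n i \<inter> \<Omega>. \<not> dominant m (E n i) (dyadic_cell m x)})"
      unfolding bad_def
      by (intro emeasure_subadditive_finite I image_subsetI nondominant_part_measurable E \<Omega>)
    also have "\<dots> \<le> (\<Sum>i\<in>I. ennreal (C * q ^ m) * frac_interaction s (E n i \<inter> \<Omega>) (UNIV - E n i))"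
      unfolding C_def q_def by (intro sum_mono nondominant_part_measure_le s E \<Omega>)
    also have "\<dots> \<le> ennreal (C * q ^ m) * ennreal (max M 0)"
      using energy[of n]
      by (auto simp flip: sum_distrib_left intro!: mult_left_mono intro: order_trans ennreal_leI)
    also have "\<dots> = ennreal (C * max M 0 * q ^ m)"
      using \<open>0 \<le> C\<close> \<open>0 < q\<close> by (simp add: mult_ac flip: ennreal_mult)
    finally show ?thesis .
  qed

  define B where "B n = bad n (r n) \<union> bad n (r (Suc n))" for n
  have B_meas: "B n \<in> sets lebesgue" for n
    unfolding B_def by (intro sets.Un bad_meas)
  have B_le: "emeasure lebesgue (B n) \<le> ennreal (2 * C * max M 0 * q ^ n)" for n
  proof -
    have "emeasure lebesgue (B n) \<le>
        emeasure lebesgue (bad n (r n)) + emeasure lebesgue (bad n (r (Suc n)))"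
      unfolding B_def by (intro emeasure_subadditive bad_meas)
    also have "\<dots> \<le> ennreal (C * max M 0 * q ^ n) + ennreal (C * max M 0 * q ^ n)"
      by (intro add_mono bad_le)
    also have "\<dots> = ennreal (2 * C * max M 0 * q ^ n)"
      using \<open>0 \<le> C\<close> \<open>0 < q\<close> by (simp flip: ennreal_plus)
    finally show ?thesis .
  qed
  have "AE x in lebesgue. \<forall>\<^sub>F n in sequentially. x \<in> space lebesgue - B n"
  proof (rule borel_cantelli_AE1)
    show "emeasure lebesgue (B n) < \<infinity>" for n
      using le_less_trans[OF B_le[of n]] by auto
    show "summable (\<lambda>n. measure lebesgue (B n))"
    proof (rule summable_comparison_test')
      show "summable (\<lambda>n. 2 * C * max M 0 * q ^ n)"
        using \<open>0 < q\<close> \<open>q < 1\<close> by (intro summable_mult summable_geometric) auto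
      show "norm (measure lebesgue (B n)) \<le> 2 * C * max M 0 * q ^ n" for n
        using enn2real_mono[OF B_le[of n]] \<open>0 \<le> C\<close> \<open>0 < q\<close> by (simp add: measure_def)
    qed
  qed (rule B_meas)
  moreover have "AE x in lebesgue. \<forall>n. x \<in> (\<Union>i\<in>I. E n i)"
    using cover by (simp add: AE_all_countable)
  ultimately have "AE x in lebesgue. x \<in> \<Omega> \<longrightarrow> (\<exists>i\<in>I. \<forall>\<^sub>F n in sequentially. x \<in> E (r n) i)"
  proof eventually_elim
    case (elim x)
    show ?case
    proof
      assume x: "x \<in> \<Omega>"
      obtain N where N: "\<And>n. N \<le> n \<Longrightarrow> x \<notin> B n"
        using elim(1) by (auto simp: eventually_sequentially)
      have in_label: "(i, dyadic_cell n x) \<in> label n n'"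
        if "i \<in> I" "x \<in> E n' i" "x \<notin> bad n n'" for i n n'
        using that x by (auto simp: label_def bad_def)
      \<comment> \<open>The phase \<open>i\<close> of the current term and the phase \<open>j\<close> of the next one both dominate the
        cell of \<open>x\<close> in the next term, so they coincide.\<close>
      have step: "x \<in> E (r (Suc n)) i" if n: "N \<le> n" and i: "i \<in> I" "x \<in> E (r n) i" for n i
      proof -
        obtain j where j: "j \<in> I" "x \<in> E (r (Suc n)) j"
          using elim(2) by blast
        have "(i, dyadic_cell n x) \<in> label n (r (Suc n))"
          using in_label[OF i] N[OF n] label[of n] by (auto simp: B_def)
        moreover have "(j, dyadic_cell n x) \<in> label n (r (Suc n))"
          using in_label[OF j] N[OF n] by (auto simp: B_def)
        ultimately have "E (r (Suc n)) i \<inter> E (r (Suc n)) j \<noteq> {}"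
          by (intro dominant_not_disjoint[of _ _ n x] E) (auto simp: label_def)
        then show ?thesis
          using disj i(1) j by (metis disjoint_family_on_def)
      qed
      obtain i where i: "i \<in> I" "x \<in> E (r N) i"
        using elim(2) by blast
      have "x \<in> E (r n) i" if "N \<le> n" for n
        using that by (induction n rule: dec_induct) (auto intro: step i)
      then show "\<exists>i\<in>I. \<forall>\<^sub>F n in sequentially. x \<in> E (r n) i"
        using i(1) by (auto simp: eventually_sequentially)
    qed
  qed
  with r show thesis
    by (rule that)
qed

section \<open>Lower semicontinuity of the fractional perimeter\<close>

text \<open>The indicator of \<open>B\<close> agrees almost everywhere with a Borel function. For that function,
measurability of the parametric integral is part of Tonelli's theorem for the Borel product.\<close>

lemma frac_potential_measurable:
  fixes B :: "'a::euclidean_space set"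
  assumes B: "B \<in> sets lebesgue"
  shows "(\<lambda>x. \<integral>\<^sup>+y\<in>B. ennreal (1 / norm (x - y) powr p) \<partial>lebesgue) \<in> borel_measurable lebesgue"
proof -
  have "(indicator B :: 'a \<Rightarrow> ennreal) \<in> borel_measurable (completion lborel)"
    using B by simp
  from completion_ex_borel_measurable[OF this] obtain g :: "'a \<Rightarrow> ennreal"
    where g [measurable]: "g \<in> borel_measurable lborel" and "AE x in lborel. indicator B x = g x"
    by blast
  then have eq: "(\<integral>\<^sup>+y\<in>B. ennreal (1 / norm (x - y) powr p) \<partial>lebesgue) =
      (\<integral>\<^sup>+y. ennreal (1 / norm (x - y) powr p) * g y \<partial>lborel)" for x
    unfolding nn_integral_completion by (intro nn_integral_cong_AE) (auto elim: eventually_mono)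
  have "(\<lambda>x. \<integral>\<^sup>+y. ennreal (1 / norm (x - y) powr p) * g y \<partial>lborel) \<in> borel_measurable borel"
    by measurable
  then show ?thesis
    unfolding eq by (simp add: measurable_completion)
qed

text \<open>A product of indicators of \<open>A\<close> and \<open>B\<close> is at most the limit inferior of the approximating products,
so one-sided convergence of the sets suffices for Fatou's lemma.\<close>

lemma frac_interaction_le_liminf:
  fixes A B :: "'a::euclidean_space set"
  assumes A: "\<And>n. A' n \<in> sets lebesgue" and B: "\<And>n. B' n \<in> sets lebesgue"
    and A_lim: "AE x in lebesgue. x \<in> A \<longrightarrow> (\<forall>\<^sub>F n in sequentially. x \<in> A' n)"
    and B_lim: "AE x in lebesgue. x \<in> B \<longrightarrow> (\<forall>\<^sub>F n in sequentially. x \<in> B' n)"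
  shows "frac_interaction s A B \<le> liminf (\<lambda>n. frac_interaction s (A' n) (B' n))"
proof -
  let ?K = "\<lambda>x y :: 'a. ennreal (1 / norm (x - y) powr (real DIM('a) + s))"
  \<comment> \<open>The pointwise inequality behind both applications of Fatou's lemma.\<close>
  have restrict_le: "f * indicator S x \<le> liminf (\<lambda>n. f' n * indicator (S' n) x)"
    if "x \<in> S \<longrightarrow> (\<forall>\<^sub>F n in sequentially. x \<in> S' n)" "f \<le> liminf f'"
    for f and f' :: "nat \<Rightarrow> ennreal" and x :: 'a and S S'
  proof (cases "x \<in> S")
    case True
    then have "\<forall>\<^sub>F n in sequentially. f' n \<le> f' n * indicator (S' n) x"
      using that(1) by (auto elim!: eventually_mono)
    then have "liminf f' \<le> liminf (\<lambda>n. f' n * indicator (S' n) x)"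
      by (rule Liminf_mono)
    with that(2) True show ?thesis
      by simp
  qed simp
  have inner: "(\<integral>\<^sup>+y\<in>B. ?K x y \<partial>lebesgue) \<le> liminf (\<lambda>n. \<integral>\<^sup>+y\<in>B' n. ?K x y \<partial>lebesgue)" for x
  proof -
    have [measurable]: "(\<lambda>y. ?K x y) \<in> borel_measurable lebesgue"
      by (intro measurable_completion) measurable
    have "(\<integral>\<^sup>+y\<in>B. ?K x y \<partial>lebesgue) \<le>
        (\<integral>\<^sup>+y. liminf (\<lambda>n. ?K x y * indicator (B' n) y) \<partial>lebesgue)"
      using B_lim by (intro nn_integral_mono_AE) (auto elim!: eventually_mono intro!: restrict_le simp: Liminf_const)
    also have "\<dots> \<le> liminf (\<lambda>n. \<integral>\<^sup>+y\<in>B' n. ?K x y \<partial>lebesgue)"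
      using B by (intro nn_integral_liminf borel_measurable_times) auto
    finally show ?thesis .
  qed
  have outer_meas: "(\<lambda>x. (\<integral>\<^sup>+y\<in>B' n. ?K x y \<partial>lebesgue) * indicator (A' n) x) \<in> borel_measurable lebesgue" for n
    by (intro borel_measurable_times_ennreal frac_potential_measurable borel_measurable_indicator A B)
  have "frac_interaction s A B \<le>
      (\<integral>\<^sup>+x. liminf (\<lambda>n. (\<integral>\<^sup>+y\<in>B' n. ?K x y \<partial>lebesgue) * indicator (A' n) x) \<partial>lebesgue)"
    unfolding frac_interaction_def
    using A_lim by (intro nn_integral_mono_AE) (auto elim!: eventually_mono intro!: restrict_le inner)
  also have "\<dots> \<le> liminf (\<lambda>n. frac_interaction s (A' n) (B' n))"
    unfolding frac_interaction_def
    by (rule nn_integral_liminf) (rule outer_meas)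
  finally show ?thesis .
qed

text \<open>The tail infima increase with the index, so their supremum commutes with the finite sum; the sum of
the infima is at most the infimum of the sums.\<close>

lemma weighted_sum_liminf_le:
  fixes a :: "'i \<Rightarrow> nat \<Rightarrow> ennreal"
  shows "(\<Sum>i\<in>I. w i * liminf (a i)) \<le> liminf (\<lambda>n. \<Sum>i\<in>I. w i * a i n)"
proof -
  have inc: "incseq (\<lambda>n. w i * (INF m\<in>{n..}. a i m))" for i
    by (intro incseq_SucI mult_left_mono INF_superset_mono) auto
  have "(\<Sum>i\<in>I. w i * liminf (a i)) = (SUP n. \<Sum>i\<in>I. w i * (INF m\<in>{n..}. a i m))"
    by (simp add: liminf_SUP_INF SUP_mult_left_ennreal ennreal_SUP_sum inc)
  also have "\<dots> \<le> liminf (\<lambda>n. \<Sum>i\<in>I. w i * a i n)"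
    unfolding liminf_SUP_INF
    by (intro SUP_mono' INF_greatest sum_mono mult_left_mono INF_lower) auto
  finally show ?thesis .
qed

lemma liminf_add_le:
  fixes a b :: "nat \<Rightarrow> ennreal"
  shows "liminf a + liminf b \<le> liminf (\<lambda>n. a n + b n)"
  using weighted_sum_liminf_le[of "\<lambda>_. 1" "\<lambda>i. if i then a else b" UNIV]
  by (simp add: UNIV_bool add.commute)

lemma frac_perimeter_le_liminf:
  fixes E \<Omega> :: "'a::euclidean_space set"
  assumes \<Omega>: "\<Omega> \<in> sets lebesgue" and F: "\<And>n. F n \<in> sets lebesgue"
    and lim_in: "AE x in lebesgue. x \<in> E \<longrightarrow> (\<forall>\<^sub>F n in sequentially. x \<in> F n)"
    and lim_out: "AE x in lebesgue. x \<notin> E \<longrightarrow> (\<forall>\<^sub>F n in sequentially. x \<notin> F n)"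
  shows "frac_perimeter s E \<Omega> \<le> liminf (\<lambda>n. frac_perimeter s (F n) \<Omega>)"
proof -
  have compl: "UNIV - F n \<in> sets lebesgue" for n
    using F[of n] by (intro sets.Diff) auto
  have "frac_interaction s (E \<inter> \<Omega>) (UNIV - E) \<le>
      liminf (\<lambda>n. frac_interaction s (F n \<inter> \<Omega>) (UNIV - F n))"
  proof (intro frac_interaction_le_liminf sets.Int F \<Omega> compl)
    show "AE x in lebesgue. x \<in> E \<inter> \<Omega> \<longrightarrow> (\<forall>\<^sub>F n in sequentially. x \<in> F n \<inter> \<Omega>)"
      using lim_in by eventually_elim (auto elim: eventually_mono)
    show "AE x in lebesgue. x \<in> UNIV - E \<longrightarrow> (\<forall>\<^sub>F n in sequentially. x \<in> UNIV - F n)"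
      using lim_out by eventually_elim (auto elim: eventually_mono)
  qed
  moreover have "frac_interaction s (\<Omega> - E) (E - \<Omega>) \<le>
      liminf (\<lambda>n. frac_interaction s (\<Omega> - F n) (F n - \<Omega>))"
  proof (intro frac_interaction_le_liminf sets.Diff F \<Omega>)
    show "AE x in lebesgue. x \<in> \<Omega> - E \<longrightarrow> (\<forall>\<^sub>F n in sequentially. x \<in> \<Omega> - F n)"
      using lim_out by eventually_elim (auto elim: eventually_mono)
    show "AE x in lebesgue. x \<in> E - \<Omega> \<longrightarrow> (\<forall>\<^sub>F n in sequentially. x \<in> F n - \<Omega>)"
      using lim_in by eventually_elim (auto elim: eventually_mono)
  qed
  ultimately show ?thesis
    unfolding frac_perimeter_def by (rule order_trans[OF add_mono liminf_add_le])
qed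

section \<open>The Dirichlet problem\<close>

text \<open>The weights are positive, so a bound on the weighted energy bounds the interaction of every phase
with its complement, and the compactness result for clusters applies. The limit phase consists of
the exterior datum and of the points of \<open>\<Omega>\<close> that eventually stay in the phase. Almost every point
outside a limit phase lies in another one, hence eventually outside the phase of the sequence;
this is the second half of the convergence that lower semicontinuity asks for.\<close>

lemma competitors_with_bounded_energy_compact:
  fixes F :: "nat \<Rightarrow> nat \<Rightarrow> 'a::euclidean_space set"
  assumes s: "0 < s" and c: "\<And>i. i \<in> {1..k} \<Longrightarrow> 0 < c i"
    and \<Omega>: "\<Omega> \<in> sets lebesgue" "bounded \<Omega>" and D: "exterior_datum k \<Omega> D"
    and F: "\<And>n. F n \<in> competitors k \<Omega> D"
    and energy: "\<And>n. weighted_frac_perimeter s c k (F n) \<Omega> \<le> ennreal M"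
  obtains E r where "E \<in> competitors k \<Omega> D" "strict_mono r"
    "weighted_frac_perimeter s c k E \<Omega> \<le>
       liminf (\<lambda>n. weighted_frac_perimeter s c k (F (r n)) \<Omega>)"
proof -
  let ?I = "{1..k}"
  have F_meas: "F n i \<in> sets lebesgue" and F_ext: "F n i - \<Omega> = D i" if "i \<in> ?I" for n i
    using F[of n] that by (auto simp: competitors_def cluster_def)
  have F_disj: "disjoint_family_on (F n) ?I" for n
    using F[of n] by (auto simp: competitors_def cluster_def)
  have F_inter: "F n i \<inter> F n j = {}" if "i \<in> ?I" "j \<in> ?I" "i \<noteq> j" for n i j
    using F_disj[of n] that by (simp add: disjoint_family_on_def)
  have F_cover: "AE x in lebesgue. x \<in> (\<Union>i\<in>?I. F n i)" for n
  proof -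
    have "negligible (UNIV - (\<Union>i\<in>?I. F n i))"
      using F[of n] by (auto simp: competitors_def cluster_def)
    then show ?thesis
      by (intro AE_I'[of "UNIV - (\<Union>i\<in>?I. F n i)"]) (auto simp: negligible_iff_null_sets)
  qed

  have "\<exists>M'. \<forall>n. (\<Sum>i\<in>?I. frac_interaction s (F n i \<inter> \<Omega>) (UNIV - F n i)) \<le> ennreal M'"
  proof (intro exI allI)
    fix n
    have "frac_interaction s (F n i \<inter> \<Omega>) (UNIV - F n i) \<le> ennreal (1 / c i * max M 0)"
      if i: "i \<in> ?I" for i
    proof -
      have "ennreal (c i) * frac_interaction s (F n i \<inter> \<Omega>) (UNIV - F n i) \<le>
          ennreal (c i) * frac_perimeter s (F n i) \<Omega>"
        by (intro mult_left_mono) (auto simp: frac_perimeter_def)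
      also have "\<dots> \<le> weighted_frac_perimeter s c k (F n) \<Omega>"
        unfolding weighted_frac_perimeter_def using i
        by (intro member_le_sum[where f = "\<lambda>i. ennreal (c i) * frac_perimeter s (F n i) \<Omega>"]) auto
      also have "\<dots> \<le> ennreal (max M 0)"
        using energy[of n] by (auto intro: order_trans ennreal_leI)
      finally have "ennreal (1 / c i) * (ennreal (c i) * frac_interaction s (F n i \<inter> \<Omega>) (UNIV - F n i))
          \<le> ennreal (1 / c i) * ennreal (max M 0)"
        by (intro mult_left_mono) auto
      then show ?thesis
        using c[OF i] by (simp flip: mult.assoc ennreal_mult)
    qed
    then have "(\<Sum>i\<in>?I. frac_interaction s (F n i \<inter> \<Omega>) (UNIV - F n i)) \<le>
        (\<Sum>i\<in>?I. ennreal (1 / c i * max M 0))"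
      by (rule sum_mono)
    also have "\<dots> = ennreal (\<Sum>i\<in>?I. 1 / c i * max M 0)"
      using less_imp_le[OF c] by (intro sum_ennreal mult_nonneg_nonneg) auto
    finally show "(\<Sum>i\<in>?I. frac_interaction s (F n i \<inter> \<Omega>) (UNIV - F n i)) \<le> \<dots>" .
  qed
  then obtain M' where energy':
    "\<And>n. (\<Sum>i\<in>?I. frac_interaction s (F n i \<inter> \<Omega>) (UNIV - F n i)) \<le> ennreal M'"
    by blast

  obtain r where r: "strict_mono r" and stable:
    "AE x in lebesgue. x \<in> \<Omega> \<longrightarrow> (\<exists>i\<in>?I. \<forall>\<^sub>F n in sequentially. x \<in> F (r n) i)"
    by (rule cluster_subsequence_with_ae_stable_phases[OF s _ \<Omega> F_meas F_disj F_cover energy']) auto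

  define E where "E i = D i \<union> {x \<in> \<Omega>. \<forall>\<^sub>F n in sequentially. x \<in> F (r n) i}" for i
  have D_meas: "D i \<in> sets lebesgue" and D_sub: "D i \<subseteq> UNIV - \<Omega>" if "i \<in> ?I" for i
    using D that by (auto simp: exterior_datum_def)
  have D_disj: "disjoint_family_on D ?I" and D_cover: "(\<Union>i\<in>?I. D i) = UNIV - \<Omega>"
    using D by (auto simp: exterior_datum_def)
  have in_E: "\<forall>\<^sub>F n in sequentially. x \<in> F (r n) i" if i: "i \<in> ?I" and x: "x \<in> E i" for x i
  proof (cases "x \<in> D i")
    case True
    then have "x \<in> F (r n) i" for n
      using F_ext[OF i, of "r n"] by blast
    then show ?thesis
      by simp
  next
    case False
    with x show ?thesis
      by (simp add: E_def)
  qed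
  have E_disj: "E i \<inter> E j = {}" if ij: "i \<in> ?I" "j \<in> ?I" "i \<noteq> j" for i j
  proof (rule ccontr)
    assume "E i \<inter> E j \<noteq> {}"
    then obtain x where "x \<in> E i" "x \<in> E j"
      by blast
    then have "\<forall>\<^sub>F n in sequentially. x \<in> F (r n) i \<and> x \<in> F (r n) j"
      using in_E ij by (simp add: eventually_conj)
    then obtain n where "x \<in> F (r n) i \<and> x \<in> F (r n) j"
      using eventually_happens'[OF sequentially_bot] by blast
    then show False
      using F_inter[OF ij, of "r n"] by blast
  qed
  have E_cover: "AE x in lebesgue. x \<in> (\<Union>i\<in>?I. E i)"
    using stable
  proof eventually_elim
    case (elim x)
    then show ?case
      using D_cover by (cases "x \<in> \<Omega>") (auto simp: E_def)
  qed
  have E_meas: "E i \<in> sets lebesgue" if i: "i \<in> ?I" for i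
  proof -
    have "E i = D i \<union> (\<Omega> \<inter> (\<Union>N. \<Inter>n\<in>{N..}. F (r n) i))"
      by (auto simp: E_def eventually_sequentially)
    moreover have "\<dots> \<in> sets lebesgue"
      using D_meas[OF i] F_meas[OF i] \<Omega>(1)
      by (intro sets.Un sets.Int sets.countable_UN sets.countable_INT') auto
    ultimately show ?thesis
      by simp
  qed
  have "E \<in> competitors k \<Omega> D"
  proof -
    have "UNIV - (\<Union>i\<in>?I. E i) \<in> null_sets lebesgue"
      using E_cover E_meas by (subst AE_iff_null_sets) auto
    moreover have "E i - \<Omega> = D i" if "i \<in> ?I" for i
      using D_sub[OF that] by (auto simp: E_def)
    ultimately show ?thesis
      using E_meas E_disj
      by (auto simp: competitors_def cluster_def disjoint_family_on_def negligible_iff_null_sets)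
  qed
  moreover have "weighted_frac_perimeter s c k E \<Omega> \<le>
      liminf (\<lambda>n. weighted_frac_perimeter s c k (F (r n)) \<Omega>)"
  proof -
    have "frac_perimeter s (E i) \<Omega> \<le> liminf (\<lambda>n. frac_perimeter s (F (r n) i) \<Omega>)"
      if i: "i \<in> ?I" for i
    proof (rule frac_perimeter_le_liminf)
      show "AE x in lebesgue. x \<in> E i \<longrightarrow> (\<forall>\<^sub>F n in sequentially. x \<in> F (r n) i)"
        using in_E[OF i] by simp
      show "AE x in lebesgue. x \<notin> E i \<longrightarrow> (\<forall>\<^sub>F n in sequentially. x \<notin> F (r n) i)"
        using E_cover
      proof eventually_elim
        case (elim x)
        show ?case
        proof
          assume "x \<notin> E i"
          then obtain j where j: "j \<in> ?I" "x \<in> E j" "j \<noteq> i"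
            using elim by blast
          have "\<forall>\<^sub>F n in sequentially. x \<in> F (r n) j"
            by (rule in_E) fact+
          then show "\<forall>\<^sub>F n in sequentially. x \<notin> F (r n) i"
          proof (rule eventually_mono)
            fix n
            assume "x \<in> F (r n) j"
            then show "x \<notin> F (r n) i"
              using F_inter[OF i j(1), of "r n"] j(3) by blast
          qed
        qed
      qed
    qed (use \<Omega> F_meas[OF i] in auto)
    then have "weighted_frac_perimeter s c k E \<Omega> \<le>
        (\<Sum>i\<in>?I. ennreal (c i) * liminf (\<lambda>n. frac_perimeter s (F (r n) i) \<Omega>))"
      unfolding weighted_frac_perimeter_def by (intro sum_mono mult_left_mono) auto
    also have "\<dots> \<le> liminf (\<lambda>n. weighted_frac_perimeter s c k (F (r n)) \<Omega>)"
      unfolding weighted_frac_perimeter_def by (rule weighted_sum_liminf_le)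
    finally show ?thesis .
  qed
  ultimately show thesis
    using r that by blast
qed

text \<open>Give all of \<open>\<Omega>\<close> to the first phase. There is a first phase: for \<open>k = 0\<close> the exterior datum would
leave nothing outside \<open>\<Omega>\<close>, but a bounded set is not the whole space.\<close>

lemma competitors_nonempty:
  fixes \<Omega> :: "'a::euclidean_space set"
  assumes \<Omega>: "\<Omega> \<in> sets lebesgue" "bounded \<Omega>" and D: "exterior_datum k \<Omega> D"
  shows "competitors k \<Omega> D \<noteq> {}"
proof -
  have cover: "(\<Union>i\<in>{1..k}. D i) = UNIV - \<Omega>"
    using D by (auto simp: exterior_datum_def)
  have "\<Omega> \<noteq> UNIV"
    using \<Omega>(2) not_bounded_UNIV by auto
  then have "1 \<in> {1..k}"
    using cover by (cases k) auto
  define E where "E i = D i \<union> (if i = 1 then \<Omega> else {})" for i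
  have D_meas: "D i \<in> sets lebesgue" and D_sub: "D i \<inter> \<Omega> = {}" if "i \<in> {1..k}" for i
    using D that unfolding exterior_datum_def by blast+
  have D_disj: "D i \<inter> D j = {}" if "i \<in> {1..k}" "j \<in> {1..k}" "i \<noteq> j" for i j
    using D that unfolding exterior_datum_def disjoint_family_on_def by blast
  have "x \<in> (\<Union>i\<in>{1..k}. E i)" for x
  proof (cases "x \<in> \<Omega>")
    case True
    then have "x \<in> E 1"
      by (simp add: E_def)
    with \<open>1 \<in> {1..k}\<close> show ?thesis
      by (rule UN_I)
  next
    case False
    then have "x \<in> (\<Union>i\<in>{1..k}. D i)"
      using cover by simp
    then obtain i where "i \<in> {1..k}" "x \<in> D i"
      by (rule UN_E)
    then show ?thesis
      by (intro UN_I[of i]) (auto simp: E_def)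
  qed
  then have "(\<Union>i\<in>{1..k}. E i) = UNIV"
    by (rule UNIV_eq_I[THEN sym])
  moreover have "E i \<inter> E j = {}" if "i \<in> {1..k}" "j \<in> {1..k}" "i \<noteq> j" for i j
    using D_disj[OF that] D_sub[OF that(1)] D_sub[OF that(2)] that(3) unfolding E_def
    by (cases "i = 1"; cases "j = 1") auto
  moreover have "E i \<in> sets lebesgue" "E i - \<Omega> = D i" if "i \<in> {1..k}" for i
    using D_meas[OF that] D_sub[OF that] \<Omega>(1) unfolding E_def by auto
  ultimately have "E \<in> competitors k \<Omega> D"
    unfolding competitors_def cluster_def disjoint_family_on_def by simp
  then show ?thesis
    by blast
qed

theorem theorem2p1:
  fixes \<Omega> :: "'a::euclidean_space set"
    and D :: "nat \<Rightarrow> 'a set"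
    and s :: real and k :: nat and c :: "nat \<Rightarrow> real"
  assumes "0 < s" and "s < 1"
    and "\<And>i. i \<in> {1..k} \<Longrightarrow> 0 < c i"
    and "open \<Omega>" and "bounded \<Omega>" and "finite_perimeter \<Omega>"
    and "exterior_datum k \<Omega> D"
  shows "\<exists>E \<in> competitors k \<Omega> D.
           weighted_frac_perimeter s c k E \<Omega> =
             (INF F \<in> competitors k \<Omega> D. weighted_frac_perimeter s c k F \<Omega>)"
proof -
  let ?P = "\<lambda>E. weighted_frac_perimeter s c k E \<Omega>"
  define m where "m = (INF F \<in> competitors k \<Omega> D. ?P F)"
  have \<Omega>: "\<Omega> \<in> sets lebesgue"
    using \<open>open \<Omega>\<close> by auto
  have nonempty: "competitors k \<Omega> D \<noteq> {}"
    using \<Omega> assms by (intro competitors_nonempty)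
  have m_le: "m \<le> ?P E" if "E \<in> competitors k \<Omega> D" for E
    unfolding m_def using that by (rule INF_lower)
  have "\<exists>E \<in> competitors k \<Omega> D. ?P E \<le> m"
  proof (cases "m = \<infinity>")
    case True
    then show ?thesis
      using nonempty by auto
  next
    case False
    then have "m < m + 1"
      by (cases m) (auto simp flip: ennreal_1 ennreal_plus simp: ennreal_less_iff)
    obtain u where u: "\<And>n. u n \<in> ?P ` competitors k \<Omega> D" "u \<longlonglongrightarrow> m"
      using Inf_as_limit[of "?P ` competitors k \<Omega> D"] nonempty unfolding m_def by blast
    obtain N where N: "\<And>n. N \<le> n \<Longrightarrow> u n < m + 1"
      using order_tendstoD(2)[OF u(2) \<open>m < m + 1\<close>] by (auto simp: eventually_sequentially)
    have "\<forall>n. \<exists>F \<in> competitors k \<Omega> D. u n = ?P F"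
      using u(1) by blast
    then obtain F where F: "\<And>n. F n \<in> competitors k \<Omega> D" "\<And>n. u n = ?P (F n)"
      by metis
    have energy: "?P (F (n + N)) \<le> ennreal (enn2real (m + 1))" for n
      using N[of "n + N"] F(2) False by (simp add: less_imp_le less_top[symmetric] ennreal_enn2real_if)
    obtain E r where E: "E \<in> competitors k \<Omega> D" and r: "strict_mono r"
      and le: "?P E \<le> liminf (\<lambda>n. ?P (F (r n + N)))"
      by (rule competitors_with_bounded_energy_compact[where F = "\<lambda>n. F (n + N)" and c = c,
            OF assms(1) _ \<Omega> \<open>bounded \<Omega>\<close> assms(7) F(1) energy])
         (use assms(3) in auto)
    have "(\<lambda>n. u (n + N)) \<longlonglongrightarrow> m"
      using u(2) by (rule LIMSEQ_ignore_initial_segment)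
    from LIMSEQ_subseq_LIMSEQ[OF this r] have "(\<lambda>n. ?P (F (r n + N))) \<longlonglongrightarrow> m"
      by (simp add: F(2) comp_def)
    then have "liminf (\<lambda>n. ?P (F (r n + N))) = m"
      by (intro lim_imp_Liminf) auto
    with E le show ?thesis
      by auto
  qed
  then show ?thesis
    using m_le unfolding m_def[symmetric] by (metis antisym)
qed

end
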